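(* Let $\mathbb{G}$ be a compact Lie group with Laplace–Beltrami operator $\mathcal{L}$. Let $(u_0,u_1)\in H^1_{\mathcal{L}}(\mathbb{G})\times L^2(\mathbb{G})$ be nonnegative and not both trivial functions. Let $p>1$ and, for $\varepsilon>0$, let $$u\in \mathcal{C}\left([0,T),H^1_{\mathcal{L}}(\mathbb{G})\right)\cap \mathcal{C}^1\left([0,T),L^2(\mathbb{G})\right)\cap L^p_{\mathrm{loc}}\left([0,T)\times\mathbb{G}\right)$$ be an energy solution, with lifespan $T=T(\varepsilon)$, to the Cauchy problem $$\begin{cases} \partial_t^2 u-\mathcal{L}u=|u|^p, & x\in\mathbb{G},\ t>0,\\ u(0,x)=\varepsilon u_0(x), & x\in\mathbb{G},\\ \partial_t u(0,x)=\varepsilon u_1(x), & x\in\mathbb{G}.\end{cases}$$ Then there exists a positive constant $\varepsilon_0=\varepsilon_0(u_0,u_1,p)>0$ such that for any $\varepsilon\in(0,\varepsilon_0]$ the energy solution $u$ blows up in finite time. Moreover, the upper bound estimates for the lifespan $$T(\varepsilon)\leqslant \begin{cases} C\,\varepsilon^{-\frac{p-1}{p+1}} & \text{if } u_1\neq 0,\\ C\,\varepsilon^{-\frac{p-1}{2}} & \text{if } u_1=0,\end{cases}$$ hold for any $\varepsilon\in(0,\varepsilon_0]$, where the constant $C>0$ is independent of $\varepsilon$.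
   Context: $\mathcal{L}$ is the Laplace–Beltrami operator on $\mathbb{G}$ which coincides with the Casimir element of the enveloping algebra (i.e. it is taken with respect to a bi-invariant Riemannian metric). $\mathrm{d}x$ is the normalized Haar measure on $\mathbb{G}$ and $L^q(\mathbb{G})$ is taken with respect to it. $H^1_{\mathcal{L}}(\mathbb{G})=\{f\in L^2(\mathbb{G}):(-\mathcal{L})^{1/2}f\in L^2(\mathbb{G})\}$ with norm $\|f\|_{L^2(\mathbb{G})}+\|(-\mathcal{L})^{1/2}f\|_{L^2(\mathbb{G})}$. Energy solution: for $(u_0,u_1)\in H^1_{\mathcal{L}}(\mathbb{G})\times L^2(\mathbb{G})$, a function $u\in \mathcal{C}([0,T),H^1_{\mathcal{L}}(\mathbb{G}))\cap \mathcal{C}^1([0,T),L^2(\mathbb{G}))\cap L^p_{\mathrm{loc}}([0,T)\times\mathbb{G})$ is an energy solution on $[0,T)$ to the Cauchy problem if $$\int_{\mathbb{G}}\partial_tu(t,x)\psi(t,x)\,\mathrm{d}x-\int_{\mathbb{G}}u(t,x)\psi_s(t,x)\,\mathrm{d}x-\varepsilon\int_{\mathbb{G}}u_1(x)\psi(0,x)\,\mathrm{d}x+\varepsilon\int_{\mathbb{G}}u_0(x)\psi_s(0,x)\,\mathrm{d}x$$ $$+\int_0^t\int_{\mathbb{G}}u(s,x)\big(\psi_{ss}(s,x)-\mathcal{L}\psi(s,x)\big)\,\mathrm{d}x\,\mathrm{d}s=\int_0^t\int_{\mathbb{G}}|u(s,x)|^p\psi(s,x)\,\mathrm{d}x\,\mathrm{d}s$$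 for any $\psi\in\mathcal{C}^\infty_0([0,T)\times\mathbb{G})$ and any $t\in(0,T)$. Here $\psi_s,\psi_{ss}$ denote derivatives in the time variable. The lifespan $T(\varepsilon)$ is the maximal existence time of the solution; "blows up in finite time" means that $T(\varepsilon)<\infty$. *)

theory Defs
  imports "HOL-Analysis.Analysis"
begin

section \<open>Smooth manifolds and compact Lie groups\<close>

text \<open>
  For \<open>S\<close> open in a finite-dimensional space, \<open>Ck k f S\<close> is the usual class \<open>C\<^sup>k\<close>. Derivatives are
  taken in the full space, so the set \<open>S\<close> is always meant to be open.
\<close>

primrec Ck :: "nat \<Rightarrow> ('a::real_normed_vector \<Rightarrow> 'b::real_normed_vector) \<Rightarrow> 'a set \<Rightarrow> bool" where
  "Ck 0 f S \<longleftrightarrow> continuous_on S f"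
| "Ck (Suc k) f S \<longleftrightarrow>
     (\<exists>f'. (\<forall>x\<in>S. (f has_derivative f' x) (at x)) \<and> (\<forall>v. Ck k (\<lambda>x. f' x v) S))"

definition smooth_on :: "('a::real_normed_vector \<Rightarrow> 'b::real_normed_vector) \<Rightarrow> 'a set \<Rightarrow> bool" where
  "smooth_on f S \<longleftrightarrow> (\<forall>k. Ck k f S)"

text \<open>
  A chart is a pair of its domain and its coordinate map. The model space \<open>'e\<close> is a real normed space
  with a finite basis \<open>E\<close>, and \<open>E\<close> provides the coordinates; the class
  \<^class>\<open>euclidean_space\<close> is not used because it has no member of dimension 0, whereas finite groups
  are compact Lie groups of dimension 0.
\<close>

type_synonym ('g, 'e) chart = "'g set \<times> ('g \<Rightarrow> 'e)"

locale smooth_manifold =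
  fixes E :: "'e::real_normed_vector set"
    and A :: "('g::{t2_space, second_countable_topology}, 'e) chart set"
  assumes finite_basis: "finite E" "independent E" "span E = UNIV"
    and charts_cover: "(\<Union>(U, \<phi>)\<in>A. U) = UNIV"
    and chart: "\<And>U \<phi>. (U, \<phi>) \<in> A \<Longrightarrow>
          open U \<and> open (\<phi> ` U) \<and> homeomorphism U (\<phi> ` U) \<phi> (inv_into U \<phi>)"
    and charts_compatible: "\<And>U \<phi> V \<theta>. (U, \<phi>) \<in> A \<Longrightarrow> (V, \<theta>) \<in> A \<Longrightarrow>
          smooth_on (\<theta> \<circ> inv_into U \<phi>) (\<phi> ` (U \<inter> V))"

text \<open>Continuity of the group operations is assumed so that the sets on which their coordinate
  expressions are required to be smooth are open.\<close>

locale compact_lie_group = smooth_manifold E A + group gmult gunit ginv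
  for E :: "'e::real_normed_vector set"
    and A :: "('g::{t2_space, second_countable_topology}, 'e) chart set"
    and gmult :: "'g \<Rightarrow> 'g \<Rightarrow> 'g" and gunit :: 'g and ginv :: "'g \<Rightarrow> 'g" +
  assumes compact_group: "compact (UNIV :: 'g set)"
    and continuous_mult: "continuous_on UNIV (\<lambda>(x, y). gmult x y)"
    and continuous_inv: "continuous_on UNIV ginv"
    and smooth_mult: "\<And>U \<phi> V \<theta> W \<omega>. (U, \<phi>) \<in> A \<Longrightarrow> (V, \<theta>) \<in> A \<Longrightarrow> (W, \<omega>) \<in> A \<Longrightarrow>
          smooth_on (\<lambda>(y, z). \<omega> (gmult (inv_into U \<phi> y) (inv_into V \<theta> z)))
            {(y, z). y \<in> \<phi> ` U \<and> z \<in> \<theta> ` V \<and> gmult (inv_into U \<phi> y) (inv_into V \<theta> z) \<in> W}"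
    and smooth_inv: "\<And>U \<phi> V \<theta>. (U, \<phi>) \<in> A \<Longrightarrow> (V, \<theta>) \<in> A \<Longrightarrow>
          smooth_on (\<lambda>y. \<theta> (ginv (inv_into U \<phi> y))) {y \<in> \<phi> ` U. ginv (inv_into U \<phi> y) \<in> V}"

definition smooth_fun ::
  "('g, 'e::real_normed_vector) chart set \<Rightarrow> ('g \<Rightarrow> real) \<Rightarrow> bool" where
  "smooth_fun A f \<longleftrightarrow> (\<forall>(U, \<phi>)\<in>A. smooth_on (f \<circ> inv_into U \<phi>) (\<phi> ` U))"

definition smooth_time_fun ::
  "('g, 'e::real_normed_vector) chart set \<Rightarrow> (real \<Rightarrow> 'g \<Rightarrow> real) \<Rightarrow> bool" where
  "smooth_time_fun A \<psi> \<longleftrightarrow>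
     (\<forall>(U, \<phi>)\<in>A. smooth_on (\<lambda>(t, y). \<psi> t (inv_into U \<phi> y)) (UNIV \<times> \<phi> ` U))"

definition normalized_haar_measure ::
  "('g::topological_space \<Rightarrow> 'g \<Rightarrow> 'g) \<Rightarrow> 'g measure \<Rightarrow> bool" where
  "normalized_haar_measure gmult M \<longleftrightarrow>
     sets M = sets borel \<and> emeasure M (space M) = 1 \<and>
     (\<forall>a. distr M borel (gmult a) = M)"


section \<open>Bi-invariant Riemannian metrics and the Laplace--Beltrami operator\<close>

text \<open>
  A metric is given by its expressions in charts: \<open>g c y v w\<close> is the inner product of the tangent
  vectors with components \<open>v\<close> and \<open>w\<close> in the chart \<open>c\<close>, at the point with coordinates \<open>y\<close>.
\<close>

type_synonym ('g, 'e) metric = "('g, 'e) chart \<Rightarrow> 'e \<Rightarrow> 'e \<Rightarrow> 'e \<Rightarrow> real"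

definition preserves_metric ::
  "('g, 'e::real_normed_vector) chart set \<Rightarrow> ('g, 'e) metric \<Rightarrow> ('g \<Rightarrow> 'g) \<Rightarrow> bool" where
  "preserves_metric A g F \<longleftrightarrow>
     (\<forall>(U, \<phi>)\<in>A. \<forall>(V, \<theta>)\<in>A. \<forall>x\<in>U. F x \<in> V \<longrightarrow>
        (let D = frechet_derivative (\<theta> \<circ> F \<circ> inv_into U \<phi>) (at (\<phi> x))
         in \<forall>v w. g (V, \<theta>) (\<theta> (F x)) (D v) (D w) = g (U, \<phi>) (\<phi> x) v w))"

text \<open>Preservation by the identity map says that the chart expressions transform as a tensor.\<close>

definition riemannian_metric ::
  "('g, 'e::real_normed_vector) chart set \<Rightarrow> ('g, 'e) metric \<Rightarrow> bool" where
  "riemannian_metric A g \<longleftrightarrow>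
     (\<forall>(U, \<phi>)\<in>A.
        (\<forall>v w. smooth_on (\<lambda>y. g (U, \<phi>) y v w) (\<phi> ` U)) \<and>
        (\<forall>y\<in>\<phi> ` U. bilinear (g (U, \<phi>) y) \<and>
           (\<forall>v w. g (U, \<phi>) y v w = g (U, \<phi>) y w v) \<and>
           (\<forall>v. v \<noteq> 0 \<longrightarrow> 0 < g (U, \<phi>) y v v))) \<and>
     preserves_metric A g id"

definition bi_invariant_metric ::
  "('g, 'e::real_normed_vector) chart set \<Rightarrow> ('g \<Rightarrow> 'g \<Rightarrow> 'g) \<Rightarrow> ('g, 'e) metric \<Rightarrow> bool" where
  "bi_invariant_metric A gmult g \<longleftrightarrow>
     riemannian_metric A g \<and>
     (\<forall>a. preserves_metric A g (\<lambda>x. gmult a x) \<and> preserves_metric A g (\<lambda>x. gmult x a))"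

text \<open>The library determinant is restricted to nonempty index types; this is the same formula over a
  finite index set.\<close>

definition det_over :: "'e set \<Rightarrow> ('e \<Rightarrow> 'e \<Rightarrow> real) \<Rightarrow> real" where
  "det_over E G = (\<Sum>\<pi> | \<pi> permutes E. of_int (sign \<pi>) * (\<Prod>i\<in>E. G i (\<pi> i)))"

text \<open>
  The next three definitions concern a domain of the model space with metric \<open>h\<close>. The divergence is
  \<open>(1 / \<surd>|h|) \<Sum>\<^sub>i \<partial>\<^sub>i (\<surd>|h| X\<^sup>i)\<close>, where \<open>|h|\<close> is the determinant of the matrix of \<open>h\<close> in the basis \<open>E\<close>.
\<close>

definition gradient ::
  "('e \<Rightarrow> 'e \<Rightarrow> 'e \<Rightarrow> real) \<Rightarrow> ('e::real_normed_vector \<Rightarrow> real) \<Rightarrow> 'e \<Rightarrow> 'e" where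
  "gradient h f y = (THE v. \<forall>w. h y v w = frechet_derivative f (at y) w)"

definition divergence ::
  "'e set \<Rightarrow> ('e \<Rightarrow> 'e \<Rightarrow> 'e \<Rightarrow> real) \<Rightarrow> ('e::real_normed_vector \<Rightarrow> 'e) \<Rightarrow> 'e \<Rightarrow> real" where
  "divergence E h X y =
     (\<Sum>i\<in>E. frechet_derivative (\<lambda>z. sqrt (det_over E (h z)) * representation E (X z) i) (at y) i)
       / sqrt (det_over E (h y))"

definition local_laplacian ::
  "'e set \<Rightarrow> ('e \<Rightarrow> 'e \<Rightarrow> 'e \<Rightarrow> real) \<Rightarrow> ('e::real_normed_vector \<Rightarrow> real) \<Rightarrow> 'e \<Rightarrow> real" where
  "local_laplacian E h f = divergence E h (gradient h f)"

text \<open>For a Riemannian metric the value does not depend on the chart around \<open>x\<close> that is chosen.\<close>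

definition laplace_beltrami ::
  "'e set \<Rightarrow> ('g, 'e::real_normed_vector) chart set \<Rightarrow> ('g, 'e) metric \<Rightarrow> ('g \<Rightarrow> real) \<Rightarrow> 'g \<Rightarrow> real"
  where
  "laplace_beltrami E A g f x =
     (let c = (SOME c. c \<in> A \<and> x \<in> fst c)
      in local_laplacian E (g c) (f \<circ> inv_into (fst c) (snd c)) (snd c x))"


section \<open>Function spaces\<close>

text \<open>
  Elements of \<open>L\<^sup>2\<close> are represented by functions, so equality in \<open>L\<^sup>2\<close> is equality almost everywhere.
  In this section and the next, \<open>L\<close> stands for the Laplace--Beltrami operator.
\<close>

definition L2 :: "'g measure \<Rightarrow> ('g \<Rightarrow> real) set" where
  "L2 M = {f \<in> borel_measurable M. integrable M (\<lambda>x. (f x)\<^sup>2)}"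

definition L2_norm :: "'g measure \<Rightarrow> ('g \<Rightarrow> real) \<Rightarrow> real" where
  "L2_norm M f = sqrt (\<integral>x. (f x)\<^sup>2 \<partial>M)"

text \<open>
  The operator \<open>(-L)\<^sup>1\<^sup>/\<^sup>2\<close> by functional calculus: on a compact manifold \<open>L\<close> has an orthonormal basis of
  smooth eigenfunctions, and \<open>F\<close> is \<open>(-L)\<^sup>1\<^sup>/\<^sup>2 f\<close> iff its Fourier coefficient at each eigenfunction
  with \<open>-L e = \<mu> e\<close> is that of \<open>f\<close> times \<open>\<surd>\<mu>\<close>. This determines \<open>F\<close> almost everywhere.
\<close>

definition is_sqrt_neg_lap ::
  "'g measure \<Rightarrow> ('g, 'e::real_normed_vector) chart set \<Rightarrow> (('g \<Rightarrow> real) \<Rightarrow> 'g \<Rightarrow> real) \<Rightarrow>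
     ('g \<Rightarrow> real) \<Rightarrow> ('g \<Rightarrow> real) \<Rightarrow> bool" where
  "is_sqrt_neg_lap M A L f F \<longleftrightarrow>
     F \<in> L2 M \<and>
     (\<forall>\<mu> e. smooth_fun A e \<and> (\<forall>x. - L e x = \<mu> * e x) \<longrightarrow>
        (\<integral>x. F x * e x \<partial>M) = sqrt \<mu> * (\<integral>x. f x * e x \<partial>M))"

definition H1 ::
  "'g measure \<Rightarrow> ('g, 'e::real_normed_vector) chart set \<Rightarrow> (('g \<Rightarrow> real) \<Rightarrow> 'g \<Rightarrow> real) \<Rightarrow>
     ('g \<Rightarrow> real) set" where
  "H1 M A L = {f \<in> L2 M. \<exists>F. is_sqrt_neg_lap M A L f F}"

definition H1_norm ::
  "'g measure \<Rightarrow> ('g, 'e::real_normed_vector) chart set \<Rightarrow> (('g \<Rightarrow> real) \<Rightarrow> 'g \<Rightarrow> real) \<Rightarrow>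
     ('g \<Rightarrow> real) \<Rightarrow> real" where
  "H1_norm M A L f = L2_norm M f + L2_norm M (SOME F. is_sqrt_neg_lap M A L f F)"

definition time_interval :: "ereal \<Rightarrow> real set" where
  "time_interval T = {t. 0 \<le> t \<and> ereal t < T}"

definition continuous_in ::
  "('g \<Rightarrow> real) set \<Rightarrow> (('g \<Rightarrow> real) \<Rightarrow> real) \<Rightarrow> ereal \<Rightarrow> (real \<Rightarrow> 'g \<Rightarrow> real) \<Rightarrow> bool" where
  "continuous_in X nrm T u \<longleftrightarrow>
     (\<forall>t\<in>time_interval T. u t \<in> X \<and>
        ((\<lambda>s. nrm (\<lambda>x. u s x - u t x)) \<longlongrightarrow> 0) (at t within time_interval T))"

text \<open>\<open>v\<close> is the derivative \<open>\<partial>\<^sub>t u\<close> of \<open>u\<close> as a curve of class \<open>C\<^sup>1\<close> in \<open>L\<^sup>2\<close>.\<close>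

definition C1_L2_derivative ::
  "'g measure \<Rightarrow> ereal \<Rightarrow> (real \<Rightarrow> 'g \<Rightarrow> real) \<Rightarrow> (real \<Rightarrow> 'g \<Rightarrow> real) \<Rightarrow> bool" where
  "C1_L2_derivative M T u v \<longleftrightarrow>
     continuous_in (L2 M) (L2_norm M) T u \<and> continuous_in (L2 M) (L2_norm M) T v \<and>
     (\<forall>t\<in>time_interval T.
        ((\<lambda>s. L2_norm M (\<lambda>x. (u s x - u t x) / (s - t) - v t x)) \<longlongrightarrow> 0)
          (at t within time_interval T))"

definition Lp_loc ::
  "'g::topological_space measure \<Rightarrow> real \<Rightarrow> ereal \<Rightarrow> (real \<Rightarrow> 'g \<Rightarrow> real) \<Rightarrow> bool" where
  "Lp_loc M p T u \<longleftrightarrow>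
     (\<lambda>(t, x). u t x) \<in> borel_measurable (restrict_space (lborel \<Otimes>\<^sub>M M) (time_interval T \<times> UNIV)) \<and>
     (\<forall>K. compact K \<and> K \<subseteq> time_interval T \<times> UNIV \<longrightarrow>
        set_integrable (lborel \<Otimes>\<^sub>M M) K (\<lambda>(t, x). \<bar>u t x\<bar> powr p))"


section \<open>Energy solutions and lifespan\<close>

text \<open>
  The space \<open>C\<^sub>0\<^sup>\<infinity>([0,T) \<times> G)\<close>: functions that are smooth up to and including the boundary \<open>t = 0\<close>,
  represented by smooth extensions to all times, with compact support in \<open>[0,T) \<times> G\<close>. The
  values at negative times play no role.
\<close>

definition test_function ::
  "('g::topological_space, 'e::real_normed_vector) chart set \<Rightarrow> ereal \<Rightarrow> (real \<Rightarrow> 'g \<Rightarrow> real) \<Rightarrow> bool"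
  where
  "test_function A T \<psi> \<longleftrightarrow>
     smooth_time_fun A \<psi> \<and>
     (\<exists>K. compact K \<and> K \<subseteq> time_interval T \<times> UNIV \<and>
        (\<forall>t x. 0 \<le> t \<and> (t, x) \<notin> K \<longrightarrow> \<psi> t x = 0))"

definition energy_solution ::
  "'g::topological_space measure \<Rightarrow> ('g, 'e::real_normed_vector) chart set \<Rightarrow>
     (('g \<Rightarrow> real) \<Rightarrow> 'g \<Rightarrow> real) \<Rightarrow> real \<Rightarrow> ('g \<Rightarrow> real) \<Rightarrow> ('g \<Rightarrow> real) \<Rightarrow> real \<Rightarrow>
     ereal \<Rightarrow> (real \<Rightarrow> 'g \<Rightarrow> real) \<Rightarrow> bool" where
  "energy_solution M A L p u0 u1 \<epsilon> T u \<longleftrightarrow>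
     0 < T \<and>
     continuous_in (H1 M A L) (H1_norm M A L) T u \<and>
     Lp_loc M p T u \<and>
     (\<exists>v. C1_L2_derivative M T u v \<and>
        (\<forall>\<psi> t. test_function A T \<psi> \<and> 0 < t \<and> ereal t < T \<longrightarrow>
           (let \<psi>s = (\<lambda>s x. deriv (\<lambda>r. \<psi> r x) s);
                \<psi>ss = (\<lambda>s x. deriv (\<lambda>r. \<psi>s r x) s)
            in (\<integral>x. v t x * \<psi> t x \<partial>M) - (\<integral>x. u t x * \<psi>s t x \<partial>M)
               - \<epsilon> * (\<integral>x. u1 x * \<psi> 0 x \<partial>M) + \<epsilon> * (\<integral>x. u0 x * \<psi>s 0 x \<partial>M)
               + (LINT s:{0..t}|lborel. (\<integral>x. u s x * (\<psi>ss s x - L (\<psi> s) x) \<partial>M))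
               = (LINT s:{0..t}|lborel. (\<integral>x. \<bar>u s x\<bar> powr p * \<psi> s x \<partial>M)))))"

text \<open>
  The maximal existence time of a solution \<open>u\<close> given on \<open>[0,T)\<close>: the supremum of all times up to
  which \<open>u\<close> continues as an energy solution. It is at least \<open>T\<close>, and it is \<open>T\<close> when \<open>u\<close> is maximal.
\<close>

definition lifespan ::
  "'g::topological_space measure \<Rightarrow> ('g, 'e::real_normed_vector) chart set \<Rightarrow>
     (('g \<Rightarrow> real) \<Rightarrow> 'g \<Rightarrow> real) \<Rightarrow> real \<Rightarrow> ('g \<Rightarrow> real) \<Rightarrow> ('g \<Rightarrow> real) \<Rightarrow> real \<Rightarrow>
     ereal \<Rightarrow> (real \<Rightarrow> 'g \<Rightarrow> real) \<Rightarrow> ereal" where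
  "lifespan M A L p u0 u1 \<epsilon> T u =
     Sup {T'. T \<le> T' \<and> (\<exists>w. energy_solution M A L p u0 u1 \<epsilon> T' w \<and>
                 (\<forall>t\<in>time_interval T. AE x in M. w t x = u t x))}"

end

theory Submission
  imports Defs
begin

text \<open>
  The idea is to follow the mean \<open>U t\<close> of \<open>u t\<close> over the group. The constants are harmonic
  (\<open>laplace_beltrami_const\<close>), so \<open>L\<close> disappears when the equation is averaged, and \<open>U\<close> satisfies
  \<open>U'' = N\<close>, where \<open>N\<close> is the mean of \<open>\<bar>u\<bar>\<^sup>p\<close>, with \<open>U 0 = \<epsilon> I0\<close> and \<open>U' 0 = \<epsilon> I1\<close> for the means
  \<open>I0\<close>, \<open>I1\<close> of the data. For energy solutions this is the integrated identity
  \<open>U t = \<epsilon> I0 + \<epsilon> I1 t + \<integral>\<^sub>0\<^sup>t (t - s) N s ds\<close> of \<open>energy_solution_mean\<close>, obtained from test functions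
  that depend on time only. Such functions need a smooth cutoff (\<open>smooth_cutoff\<close>).

  The Haar measure has total mass 1, so Jensen's inequality (\<open>powr_le_integral_powr\<close>) gives
  \<open>N \<ge> U\<^sup>p\<close> wherever \<open>U\<close> is positive, at almost every time. Moreover \<open>U\<close> is nondecreasing, because
  \<open>N\<close> and \<open>I1\<close> are nonnegative. So if \<open>U \<ge> m > 0\<close> at some
  time, then after a further time \<open>\<tau>\<close> one has \<open>U \<ge> m + m\<^sup>p \<tau>\<^sup>2 / 2\<close> (\<open>U_growth\<close>). Hence \<open>U\<close> doubles within a time
  proportional to \<open>m\<^sup>-\<^sup>q\<close>, where \<open>q = (p - 1) / 2\<close>; these doubling times form a convergent geometric
  series, and the solution cannot survive its sum (\<open>life_time_le\<close>).

  If \<open>u1\<close> vanishes, then \<open>I0 > 0\<close> and the argument starts at time 0 with \<open>m = \<epsilon> I0\<close>. Otherwise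
  \<open>U t \<ge> \<epsilon> I1 t\<close>, and starting at the time \<open>t0\<close> at which the remaining life time
  \<open>(\<epsilon> I1 t0)\<^sup>-\<^sup>q\<close> is comparable to \<open>t0\<close> gives the exponent \<open>(p - 1) / (p + 1)\<close>. Both bounds hold for every
  \<open>\<epsilon> > 0\<close>, so \<open>\<epsilon>0 = 1\<close> serves as threshold.
\<close>

section \<open>Smooth cutoff functions of time\<close>

text \<open>
  Being \<open>k\<close> times differentiable on the whole line, without continuity of the last derivative. In
  this one-dimensional form closure under products and compositions follows by short inductions;
  the class \<open>Ck\<close> on product domains is reached at the end, in \<open>Ck_time_only\<close>, at the cost of one
  derivative.
\<close>
primrec k_diff :: "nat \<Rightarrow> (real \<Rightarrow> real) \<Rightarrow> bool" where
  "k_diff 0 f \<longleftrightarrow> True"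
| "k_diff (Suc k) f \<longleftrightarrow> (\<exists>f'. (\<forall>x. (f has_real_derivative f' x) (at x)) \<and> k_diff k f')"

lemma k_diff_Suc_D: "k_diff (Suc k) f \<Longrightarrow> k_diff k f"
proof (induction k arbitrary: f)
  case (Suc k)
  then obtain f' where f': "\<forall>x. (f has_real_derivative f' x) (at x)" "k_diff (Suc k) f'"
    by auto
  then show ?case
    using Suc.IH[of f'] by (auto intro!: exI[of _ f'])
qed simp

lemma k_diff_Suc_I:
  "(\<And>x. (f has_real_derivative f' x) (at x)) \<Longrightarrow> k_diff k f' \<Longrightarrow> k_diff (Suc k) f"
  by auto

lemma k_diff_const: "k_diff k (\<lambda>_. c)"
proof (induction k arbitrary: c)
  case (Suc k)
  show ?case by (rule k_diff_Suc_I[OF DERIV_const Suc.IH])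
qed simp

lemma k_diff_ident: "k_diff k (\<lambda>x. x)"
  by (cases k) (simp, metis k_diff_Suc_I DERIV_ident k_diff_const)

lemma k_diff_add: "k_diff k f \<Longrightarrow> k_diff k g \<Longrightarrow> k_diff k (\<lambda>x. f x + g x)"
proof (induction k arbitrary: f g)
  case (Suc k)
  then obtain f' g' where fg: "\<And>x. (f has_real_derivative f' x) (at x)" "k_diff k f'"
    "\<And>x. (g has_real_derivative g' x) (at x)" "k_diff k g'"
    by auto
  show ?case
    by (rule k_diff_Suc_I[OF DERIV_add[OF fg(1,3)] Suc.IH[OF fg(2,4)]])
qed simp

lemma k_diff_mult: "k_diff k f \<Longrightarrow> k_diff k g \<Longrightarrow> k_diff k (\<lambda>x. f x * g x)"
proof (induction k arbitrary: f g)
  case (Suc k)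
  then obtain f' g' where fg: "\<And>x. (f has_real_derivative f' x) (at x)" "k_diff k f'"
    "\<And>x. (g has_real_derivative g' x) (at x)" "k_diff k g'"
    by auto
  have "k_diff k (\<lambda>x. f' x * g x + g' x * f x)"
    by (rule k_diff_add[OF Suc.IH[OF fg(2) k_diff_Suc_D[OF Suc.prems(2)]]
          Suc.IH[OF fg(4) k_diff_Suc_D[OF Suc.prems(1)]]])
  with DERIV_mult[OF fg(1,3)] show ?case
    by (rule k_diff_Suc_I)
qed simp

lemma k_diff_compose: "k_diff k f \<Longrightarrow> k_diff k g \<Longrightarrow> k_diff k (\<lambda>x. f (g x))"
proof (induction k arbitrary: f g)
  case (Suc k)
  then obtain f' g' where fg: "\<And>x. (f has_real_derivative f' x) (at x)" "k_diff k f'"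
    "\<And>x. (g has_real_derivative g' x) (at x)" "k_diff k g'"
    by auto
  have "k_diff k (\<lambda>x. f' (g x) * g' x)"
    by (rule k_diff_mult[OF Suc.IH[OF fg(2) k_diff_Suc_D[OF Suc.prems(2)]] fg(4)])
  with DERIV_chain2[OF fg(1,3)] show ?case
    by (rule k_diff_Suc_I)
qed simp

text \<open>
  \<open>flat_exp 0\<close> is the classical function \<open>exp (- 1 / x)\<close>, continued by 0, which is flat at 0.
  The factor \<open>x\<^sup>-\<^sup>n\<close> makes the family closed under differentiation up to linear combinations, so
  smoothness of all members follows by a single induction.
\<close>
definition flat_exp :: "nat \<Rightarrow> real \<Rightarrow> real" where
  "flat_exp n x = (if 0 < x then inverse x ^ n * exp (- inverse x) else 0)"

lemma flat_exp_tendsto_0: "(flat_exp n \<longlongrightarrow> 0) (at_right 0)"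
proof -
  have "((\<lambda>x. inverse x ^ n / exp (inverse x)) \<longlongrightarrow> (0::real)) (at_right 0)"
    by (rule filterlim_compose[OF tendsto_power_div_exp_0 filterlim_inverse_at_top_right])
  moreover have "eventually (\<lambda>x. inverse x ^ n / exp (inverse x) = flat_exp n x) (at_right 0)"
    unfolding eventually_at_right_field
    by (intro exI[of _ 1]) (auto simp: flat_exp_def exp_minus field_simps)
  ultimately show ?thesis
    by (rule Lim_transform_eventually)
qed

text \<open>
  At 0 the difference quotient of \<open>flat_exp n\<close> is \<open>flat_exp (Suc n)\<close> on the right, which tends to 0
  because exponentials beat powers.
\<close>
lemma flat_exp_has_derivative:
  "(flat_exp n has_real_derivative - real n * flat_exp (Suc n) x + flat_exp (n + 2) x) (at x)"
proof -
  consider "0 < x" | "x < 0" | "x = 0" by linarith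
  then show ?thesis
  proof cases
    case 1
    have "((\<lambda>x. inverse x ^ n * exp (- inverse x)) has_real_derivative
        real n * inverse x ^ (n - 1) * - (inverse x * inverse x) * exp (- inverse x)
        + inverse x ^ n * (exp (- inverse x) * (inverse x * inverse x))) (at x)"
      using 1 by (auto intro!: derivative_eq_intros)
    moreover have "real n * inverse x ^ (n - 1) * - (inverse x * inverse x) * exp (- inverse x)
        + inverse x ^ n * (exp (- inverse x) * (inverse x * inverse x))
        = - real n * flat_exp (Suc n) x + flat_exp (n + 2) x"
      using 1 by (cases n) (simp_all add: flat_exp_def algebra_simps)
    ultimately have d: "((\<lambda>x. inverse x ^ n * exp (- inverse x)) has_real_derivative
        - real n * flat_exp (Suc n) x + flat_exp (n + 2) x) (at x)"
      by simp
    show ?thesis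
      by (rule has_field_derivative_transform_within_open[OF d open_greaterThan[of 0]])
         (use 1 in \<open>auto simp: flat_exp_def\<close>)
  next
    case 2
    have d: "((\<lambda>x. 0) has_real_derivative
        - real n * flat_exp (Suc n) x + flat_exp (n + 2) x) (at x)"
      using 2 by (auto simp: flat_exp_def)
    show ?thesis
      by (rule has_field_derivative_transform_within_open[OF d open_lessThan[of 0]])
         (use 2 in \<open>auto simp: flat_exp_def\<close>)
  next
    case 3
    have "((\<lambda>h. flat_exp n h / h) \<longlongrightarrow> 0) (at_right 0)"
    proof (rule Lim_transform_eventually[OF flat_exp_tendsto_0[of "Suc n"]])
      show "eventually (\<lambda>h. flat_exp (Suc n) h = flat_exp n h / h) (at_right 0)"
        unfolding eventually_at_right_field
        by (intro exI[of _ 1]) (auto simp: flat_exp_def field_simps)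
    qed
    moreover have "((\<lambda>h. flat_exp n h / h) \<longlongrightarrow> 0) (at_left 0)"
    proof (rule Lim_transform_eventually[OF tendsto_const])
      show "eventually (\<lambda>h. 0 = flat_exp n h / h) (at_left 0)"
        unfolding eventually_at_left_field
        by (intro exI[of _ "-1"]) (auto simp: flat_exp_def)
    qed
    ultimately have "((\<lambda>h. flat_exp n h / h) \<longlongrightarrow> 0) (at 0)"
      by (simp add: filterlim_at_split)
    then show ?thesis
      using 3 by (simp add: DERIV_def flat_exp_def)
  qed
qed

lemma k_diff_flat_exp: "k_diff k (flat_exp n)"
proof (induction k arbitrary: n)
  case (Suc k)
  show ?case
    by (rule k_diff_Suc_I[OF flat_exp_has_derivative
          k_diff_add[OF k_diff_mult[OF k_diff_const Suc.IH] Suc.IH]])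
qed simp

lemma flat_exp_mono: "x \<le> y \<Longrightarrow> flat_exp 0 x \<le> flat_exp 0 y"
  by (cases "0 < x") (simp_all add: flat_exp_def le_imp_inverse_le)

text \<open>
  With \<open>h = flat_exp 0\<close> and \<open>c = h (b - a)\<close>, the function \<open>h (c - h (t - a)) / h c\<close> is such a cutoff: the
  inner \<open>h\<close> is 0 up to time \<open>a\<close> and, by monotonicity, at least \<open>c\<close> from time \<open>b\<close> on, where the outer
  argument is then nonpositive. Nesting \<open>h\<close> in this way avoids a variable denominator.
\<close>
lemma smooth_cutoff:
  fixes a b :: real
  assumes "a < b"
  obtains \<eta> where "\<And>k. k_diff k \<eta>" "\<And>t. t \<le> a \<Longrightarrow> \<eta> t = 1" "\<And>t. b \<le> t \<Longrightarrow> \<eta> t = 0"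
proof
  define c where "c = flat_exp 0 (b - a)"
  define \<eta> where "\<eta> = (\<lambda>t. flat_exp 0 (c + (-1) * flat_exp 0 (t + - a)) * inverse (flat_exp 0 c))"
  have c: "0 < c" using assms by (simp add: c_def flat_exp_def)
  show "k_diff k \<eta>" for k
  proof -
    have "k_diff k (\<lambda>t. flat_exp 0 (t + - a))"
      by (rule k_diff_compose[OF k_diff_flat_exp k_diff_add[OF k_diff_ident k_diff_const]])
    then have "k_diff k (\<lambda>t. c + (-1) * flat_exp 0 (t + - a))"
      by (rule k_diff_add[OF k_diff_const k_diff_mult[OF k_diff_const]])
    then show ?thesis
      unfolding \<eta>_def
      by (rule k_diff_mult[OF k_diff_compose[OF k_diff_flat_exp] k_diff_const])
  qed
  show "\<eta> t = 1" if "t \<le> a" for t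
  proof -
    have "flat_exp 0 (t + - a) = 0" using that by (simp add: flat_exp_def)
    then show ?thesis using c by (simp add: \<eta>_def flat_exp_def)
  qed
  show "\<eta> t = 0" if "b \<le> t" for t
  proof -
    have "c \<le> flat_exp 0 (t + - a)"
      unfolding c_def using that by (intro flat_exp_mono) simp
    then show ?thesis by (simp add: \<eta>_def flat_exp_def[of 0 "c - flat_exp 0 (t - a)"])
  qed
qed

text \<open>
  The factor \<open>c\<close> makes the induction go through: the derivative in the direction \<open>(h, w)\<close> is
  \<open>c h f'\<close>, again a constant multiple of a function of time.
\<close>
lemma Ck_time_only:
  assumes "k_diff (Suc k) f"
  shows "Ck k (\<lambda>(t, y). c * f t) S"
  using assms
proof (induction k arbitrary: f c)
  case 0
  then obtain f' where "\<forall>x. (f has_real_derivative f' x) (at x)" by auto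
  then have "continuous_on UNIV f"
    by (auto intro!: DERIV_isCont continuous_at_imp_continuous_on)
  then show ?case
    by (auto simp: case_prod_beta intro!: continuous_intros continuous_on_compose2[of UNIV f])
next
  case (Suc k)
  then obtain f' where f': "\<forall>x. (f has_real_derivative f' x) (at x)" "k_diff (Suc k) f'"
    by (metis k_diff.simps(2))
  have "((\<lambda>(t, y). c * f t) has_derivative (\<lambda>(h, w). (c * h) * f' (fst z))) (at z)"
    for z :: "real \<times> 'a"
  proof -
    have "((\<lambda>z. f (fst z)) has_derivative (\<lambda>v. fst v * f' (fst z))) (at z)"
      using f'(1) by (intro DERIV_compose_FDERIV[of f "f' (fst z)"] has_derivative_fst has_derivative_ident) auto
    then have "((\<lambda>z. c * f (fst z)) has_derivative (\<lambda>v. c * (fst v * f' (fst z)))) (at z)"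
      by (rule has_derivative_mult_right)
    then show ?thesis by (simp add: case_prod_unfold mult.assoc)
  qed
  moreover have "Ck k (\<lambda>x. (\<lambda>(h, w). (c * h) * f' (fst x)) v) S" for v
    using Suc.IH[OF f'(2), of "c * fst v"] by (simp add: case_prod_beta)
  ultimately show ?case
    by (auto intro!: exI[of _ "\<lambda>x (h, w). (c * h) * f' (fst x)"] simp del: split_paired_All)
qed

lemma smooth_time_fun_time_only:
  assumes "\<And>k. k_diff k f"
  shows "smooth_time_fun A (\<lambda>t x. f t)"
  using Ck_time_only[OF assms, of _ 1] by (auto simp: smooth_time_fun_def smooth_on_def)

section \<open>The Laplacian of a constant\<close>

lemma gradient_const:
  assumes "bilinear (h y)" "\<And>v. v \<noteq> 0 \<Longrightarrow> 0 < h y v v"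
  shows "gradient h (\<lambda>_. c) y = 0"
  unfolding gradient_def
proof (rule the_equality)
  show "\<forall>w. h y 0 w = frechet_derivative (\<lambda>_. c) (at y) w"
    by (simp add: bilinear_lzero[OF assms(1)])
  show "v = 0" if "\<forall>w. h y v w = frechet_derivative (\<lambda>_. c) (at y) w" for v
    using assms(2)[of v] that by force
qed

text \<open>
  In any chart the gradient of a constant vanishes on the whole coordinate domain, because the metric
  is definite there. The divergence differentiates the gradient field at an interior point of that
  domain, so its value there is 0 whatever the field is elsewhere.
\<close>
lemma laplace_beltrami_const:
  assumes "smooth_manifold E A" "riemannian_metric A g"
  shows "laplace_beltrami E A g (\<lambda>_. c) x = 0"
proof -
  interpret smooth_manifold E A by fact
  define ch where "ch = (SOME ch. ch \<in> A \<and> x \<in> fst ch)"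
  have "\<exists>ch. ch \<in> A \<and> x \<in> fst ch"
    using charts_cover by fastforce
  then have ch: "ch \<in> A" "x \<in> fst ch"
    unfolding ch_def by (metis (mono_tags, lifting) someI_ex)+
  obtain U \<phi> where U: "ch = (U, \<phi>)" by (cases ch)
  have grad: "gradient (g ch) (\<lambda>_. c) y = 0" if "y \<in> \<phi> ` U" for y
    using assms(2) ch(1) that unfolding riemannian_metric_def U
    by (intro gradient_const) auto
  have "open (\<phi> ` U)" "\<phi> x \<in> \<phi> ` U"
    using chart ch U by auto
  then have "((\<lambda>z. sqrt (det_over E (g ch z)) * representation E (gradient (g ch) (\<lambda>_. c) z) i)
      has_derivative (\<lambda>_. 0)) (at (\<phi> x))" for i
    by (intro has_derivative_transform_within_open[OF has_derivative_const[of 0]])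
       (auto simp: grad representation_zero)
  then have "frechet_derivative
      (\<lambda>z. sqrt (det_over E (g ch z)) * representation E (gradient (g ch) (\<lambda>_. c) z) i) (at (\<phi> x))
      = (\<lambda>_. 0)" for i
    by (metis frechet_derivative_at)
  then show ?thesis
    unfolding laplace_beltrami_def ch_def[symmetric]
    by (simp add: Let_def local_laplacian_def divergence_def U comp_def)
qed

section \<open>Blow-up for an integrated differential inequality\<close>

lemma powr_above_tangent:
  fixes p x m :: real
  assumes "1 < p" "0 \<le> x" "0 < m"
  shows "m powr p + p * m powr (p - 1) * (x - m) \<le> x powr p"
proof (cases "x = 0")
  case True
  have "m powr p = m powr (p - 1) * m"
    using assms powr_mult_base[of m "p - 1"] by (simp add: mult.commute)
  then have "m powr p + p * m powr (p - 1) * (0 - m) = (1 - p) * m powr p"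
    by (simp add: algebra_simps)
  also have "\<dots> \<le> 0"
    using assms by (intro mult_nonpos_nonneg) auto
  finally show ?thesis using True by simp
next
  case False
  have "p * m powr (p - 1) * (x - m) \<le> x powr p - m powr p"
    using assms False
    by (intro convex_on_imp_above_tangent[where A = "{0<..}"] powr_convex)
       (auto intro!: derivative_eq_intros simp: interior_open)
  then show ?thesis by simp
qed

text \<open>
  Jensen's inequality for \<open>\<bar>y\<bar>\<^sup>p\<close>, obtained by integrating the tangent inequality at \<open>m\<close>. A lower bound
  \<open>m\<close> of the mean is used in place of the mean since this is the form that the iteration needs.
\<close>
lemma powr_le_integral_powr:
  fixes f :: "'a \<Rightarrow> real"
  assumes prob: "emeasure M (space M) = 1"
    and p: "1 < p" and m: "0 < m" "m \<le> (\<integral>x. f x \<partial>M)"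
    and int: "integrable M f" "integrable M (\<lambda>x. \<bar>f x\<bar> powr p)"
  shows "m powr p \<le> (\<integral>x. \<bar>f x\<bar> powr p \<partial>M)"
proof -
  interpret finite_measure M
    by standard (simp add: prob)
  have one: "measure M (space M) = 1"
    using prob by (simp add: measure_def)
  have "(\<integral>x. m powr p + p * m powr (p - 1) * (\<bar>f x\<bar> - m) \<partial>M)
      = m powr p + p * m powr (p - 1) * ((\<integral>x. \<bar>f x\<bar> \<partial>M) - m)"
    using int by (simp add: one)
  moreover have "m \<le> (\<integral>x. \<bar>f x\<bar> \<partial>M)"
    using m integral_abs_bound[of M f] by linarith
  ultimately have "m powr p \<le> (\<integral>x. m powr p + p * m powr (p - 1) * (\<bar>f x\<bar> - m) \<partial>M)"
    using p by simp
  also have "\<dots> \<le> (\<integral>x. \<bar>f x\<bar> powr p \<partial>M)"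
    using int p m by (intro integral_mono powr_above_tangent) auto
  finally show ?thesis .
qed

text \<open>
  The integral relations to which the Cauchy problem is reduced: \<open>U\<close> is the mean of the solution,
  \<open>N\<close> the mean of \<open>\<bar>u\<bar>\<^sup>p\<close>, and \<open>U_eq\<close> is the twice integrated form of \<open>U'' = N\<close>, \<open>U 0 = a\<close>,
  \<open>U' 0 = b\<close>. The bound \<open>N_lower\<close> states \<open>N s \<ge> (U s)\<^sup>p\<close> through lower bounds \<open>m\<close> of \<open>U s\<close>; it is
  required for almost every \<open>s\<close> only, as \<open>\<bar>u s\<bar>\<^sup>p\<close> may fail to be integrable for exceptional \<open>s\<close>.
\<close>
locale iteration_frame =
  fixes p a b :: real and T :: ereal and N U :: "real \<Rightarrow> real"
  assumes p: "1 < p" and a: "0 \<le> a" and b: "0 \<le> b"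
    and N_integrable: "\<And>t. 0 \<le> t \<Longrightarrow> ereal t < T \<Longrightarrow> set_integrable lborel {0..t} N"
    and N_nonneg: "\<And>s. 0 \<le> N s"
    and U_eq: "\<And>t. U t = a + b * t + (LINT s:{0..t}|lborel. (t - s) * N s)"
    and N_lower: "\<And>t. 0 \<le> t \<Longrightarrow> ereal t < T \<Longrightarrow>
      AE s in lborel. 0 < s \<and> s \<le> t \<longrightarrow> (\<forall>m. 0 < m \<and> m \<le> U s \<longrightarrow> m powr p \<le> N s)"
begin

lemma kernel_integrable:
  assumes "0 \<le> t" "ereal t < T"
  shows "set_integrable lborel {0..t} (\<lambda>s. (t - s) * N s)"
proof (rule set_integrable_bound)
  show "set_integrable lborel {0..t} (\<lambda>s. t * N s)"
    using N_integrable[OF assms] by (intro set_integrable_mult_right)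
  have "set_borel_measurable lborel {0..t} N"
    using N_integrable[OF assms] by (simp add: set_integrable_def set_borel_measurable_def)
  then have "(\<lambda>s. (t - s) * (indicator {0..t} s *\<^sub>R N s)) \<in> borel_measurable lborel"
    unfolding set_borel_measurable_def by (intro borel_measurable_times) auto
  then show "set_borel_measurable lborel {0..t} (\<lambda>s. (t - s) * N s)"
    unfolding set_borel_measurable_def by (simp add: ac_simps)
  show "AE s in lborel. s \<in> {0..t} \<longrightarrow> norm ((t - s) * N s) \<le> norm (t * N s)"
    using N_nonneg by (auto simp: abs_mult intro!: mult_right_mono)
qed

text \<open>
  The kernel \<open>max (t - s) 0\<close> increases with \<open>t\<close>, so passing from \<open>t0\<close> to \<open>t\<close> gains at least the part of
  the integral over \<open>{t0..t}\<close>, where \<open>N\<close> is bounded below by \<open>c\<close>.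
\<close>
lemma U_increment:
  assumes t: "0 \<le> t0" "t0 \<le> t" "ereal t < T"
    and low: "AE s in lborel. s \<in> {t0..t} \<longrightarrow> c \<le> N s"
  shows "U t0 + c * (t - t0)\<^sup>2 / 2 \<le> U t"
proof -
  have t0: "ereal t0 < T" using t by (meson ereal_less_eq(3) le_less_trans)
  note int = kernel_integrable[OF order_trans[OF t(1,2)] t(3)] kernel_integrable[OF t(1) t0]
  have FTC: "has_bochner_integral lborel (\<lambda>s. indicator {t0..t} s *\<^sub>R (c * (t - s)))
      (- c * (t - t)\<^sup>2 / 2 - (- c * (t - t0)\<^sup>2 / 2))"
    using t by (intro has_bochner_integral_FTC_Icc)
      (auto intro!: derivative_eq_intros continuous_intros
        simp: has_real_derivative_iff_has_vector_derivative[symmetric] field_simps)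
  have "c * (t - t0)\<^sup>2 / 2 = (LINT s|lborel. indicator {t0..t} s *\<^sub>R (c * (t - s)))"
    using has_bochner_integral_integral_eq[OF FTC] by simp
  also have "\<dots> \<le> (LINT s|lborel. indicator {0..t} s *\<^sub>R ((t - s) * N s)
      - indicator {0..t0} s *\<^sub>R ((t0 - s) * N s))"
  proof (rule integral_mono_AE)
    show "integrable lborel (\<lambda>s. indicator {t0..t} s *\<^sub>R (c * (t - s)))"
      using FTC by (rule integrable.intros)
    show "integrable lborel (\<lambda>s. indicator {0..t} s *\<^sub>R ((t - s) * N s)
      - indicator {0..t0} s *\<^sub>R ((t0 - s) * N s))"
      using int unfolding set_integrable_def by (rule Bochner_Integration.integrable_diff)
    show "AE s in lborel. indicator {t0..t} s *\<^sub>R (c * (t - s))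
      \<le> indicator {0..t} s *\<^sub>R ((t - s) * N s) - indicator {0..t0} s *\<^sub>R ((t0 - s) * N s)"
      using low AE_lborel_singleton[of t0]
    proof eventually_elim
      case (elim s)
      consider "s < t0" | "t0 < s" "s \<le> t" | "t < s" using elim by linarith
      then show ?case
      proof cases
        case 1
        then show ?thesis using t N_nonneg[of s]
          by (auto simp: indicator_def intro!: mult_right_mono)
      next
        case 2
        then have "c * (t - s) \<le> N s * (t - s)"
          using elim by (intro mult_right_mono) auto
        then show ?thesis using 2 t by (simp add: indicator_def mult.commute)
      next
        case 3
        then show ?thesis using t by (simp add: indicator_def)
      qed
    qed
  qed
  also have "\<dots> = (LINT s:{0..t}|lborel. (t - s) * N s) - (LINT s:{0..t0}|lborel. (t0 - s) * N s)"
    using int unfolding set_integrable_def set_lebesgue_integral_def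
    by (rule Bochner_Integration.integral_diff)
  also have "\<dots> = U t - U t0 - b * (t - t0)"
    by (simp add: U_eq[of t] U_eq[of t0] algebra_simps)
  also have "\<dots> \<le> U t - U t0"
    using b t by simp
  finally show ?thesis by simp
qed

lemma U_mono: "0 \<le> t0 \<Longrightarrow> t0 \<le> t \<Longrightarrow> ereal t < T \<Longrightarrow> U t0 \<le> U t"
  using U_increment[of t0 t 0] N_nonneg by simp

lemma U_growth:
  assumes t: "0 \<le> t0" "t0 \<le> t" "ereal t < T" and m: "0 < m" "m \<le> U t0"
  shows "m + m powr p * (t - t0)\<^sup>2 / 2 \<le> U t"
proof -
  have "AE s in lborel. s \<in> {t0..t} \<longrightarrow> m powr p \<le> N s"
    using N_lower[OF order_trans[OF t(1,2)] t(3)] AE_lborel_singleton[of 0]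
  proof eventually_elim
    case (elim s)
    show ?case
    proof
      assume s: "s \<in> {t0..t}"
      then have "ereal s < T" using t by (meson atLeastAtMost_iff ereal_less_eq(3) le_less_trans)
      then have "m \<le> U s" using U_mono[of t0 s] t m s by auto
      then show "m powr p \<le> N s" using elim s t m by auto
    qed
  qed
  from U_increment[OF t this] m show ?thesis by linarith
qed

text \<open>
  By \<open>U_growth\<close>, a value at least \<open>m\<close> doubles within time \<open>sqrt 2 * m powr - q\<close> with \<open>q = (p - 1) / 2\<close>.
  After \<open>k\<close> doublings this waiting time has shrunk by the factor \<open>2 powr (- q * k)\<close>, so all
  doublings happen before the sum of a geometric series, and the value of \<open>U\<close> at
  that sum would exceed every real number.
\<close>
lemma life_time_le:
  assumes t0: "0 \<le> t0" and m: "0 < m" "m \<le> U t0"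
  shows "T \<le> ereal (t0 + sqrt 2 / (1 - 2 powr - ((p - 1) / 2)) * m powr - ((p - 1) / 2))"
proof (rule ccontr)
  define q where "q = (p - 1) / 2"
  define r where "r = (2::real) powr - q"
  define d where "d = sqrt 2 * m powr - q"
  define \<tau> where "\<tau> = (\<lambda>k. t0 + d * (\<Sum>i<k. r ^ i))"
  define t' where "t' = t0 + d / (1 - r)"
  assume "\<not> ?thesis"
  then have t': "ereal t' < T"
    by (simp add: t'_def d_def r_def q_def)
  have q: "0 < q" using p by (simp add: q_def)
  have r: "0 < r" "r < 1"
    using q powr_less_mono[of "- q" 0 2] by (auto simp: r_def)
  have d: "0 < d" using m by (simp add: d_def)
  have \<tau>_le: "\<tau> k \<le> t'" for k
  proof -
    have "(\<Sum>i<k. r ^ i) \<le> 1 / (1 - r)"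
      using r by (simp add: sum_gp_strict divide_right_mono)
    then show ?thesis
      using d unfolding \<tau>_def t'_def by (simp add: mult_left_mono divide_inverse)
  qed
  have \<tau>_T: "ereal (\<tau> k) < T" for k
    using \<tau>_le[of k] t' by (meson ereal_less_eq(3) le_less_trans)
  have \<tau>_ge: "0 \<le> \<tau> k" for k
    using t0 d r by (auto simp: \<tau>_def intro!: add_nonneg_nonneg mult_nonneg_nonneg sum_nonneg)
  have doubling: "2 ^ k * m \<le> U (\<tau> k)" for k
  proof (induction k)
    case 0
    then show ?case using m(2) by (simp add: \<tau>_def)
  next
    case (Suc k)
    have step: "\<tau> (Suc k) - \<tau> k = d * r ^ k"
      by (simp add: \<tau>_def algebra_simps)
    have "(2 ^ k * m) powr p * (d * r ^ k)\<^sup>2 / 2 = 2 ^ k * m"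
    proof -
      have "d * r ^ k = sqrt 2 * (2 ^ k * m) powr - q"
        using m by (simp add: d_def r_def powr_mult powr_realpow[symmetric] powr_powr mult.commute)
      then have "(d * r ^ k)\<^sup>2 = 2 * ((2 ^ k * m) powr - q)\<^sup>2"
        by (simp add: power_mult_distrib)
      also have "((2 ^ k * m) powr - q)\<^sup>2 = (2 ^ k * m) powr (1 - p)"
      proof -
        have "- q + - q = 1 - p" by (simp add: q_def field_simps)
        then show ?thesis by (simp only: power2_eq_square powr_add[symmetric])
      qed
      finally show ?thesis
        using m by (simp add: powr_add[symmetric] mult_pos_pos)
    qed
    moreover have "2 ^ k * m + (2 ^ k * m) powr p * (\<tau> (Suc k) - \<tau> k)\<^sup>2 / 2 \<le> U (\<tau> (Suc k))"
    proof (rule U_growth)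
      show "\<tau> k \<le> \<tau> (Suc k)" using step d r by (smt (verit) mult_pos_pos zero_less_power)
    qed (use \<tau>_ge \<tau>_T Suc m in auto)
    ultimately show ?case
      by (simp add: step mult_ac)
  qed
  obtain k where "U t' / m < 2 ^ k"
    using real_arch_pow[of 2 "U t' / m"] by auto
  then have "U t' < 2 ^ k * m"
    using m by (simp add: field_simps)
  also have "\<dots> \<le> U (\<tau> k)" by (rule doubling)
  also have "\<dots> \<le> U t'" using \<tau>_ge \<tau>_le t' by (rule U_mono)
  finally show False by simp
qed

lemma U_ge_linear:
  assumes "0 \<le> t"
  shows "a + b * t \<le> U t"
proof -
  have "0 \<le> (LINT s:{0..t}|lborel. (t - s) * N s)"
    unfolding set_lebesgue_integral_def using N_nonneg
    by (intro integral_nonneg_AE) (auto simp: indicator_def)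
  then show ?thesis by (simp add: U_eq)
qed

lemma life_time_le_position:
  assumes "0 < a"
  shows "T \<le> ereal (sqrt 2 / (1 - 2 powr - ((p - 1) / 2)) * a powr - ((p - 1) / 2))"
  using life_time_le[of 0 a] U_ge_linear[of 0] assms by simp

text \<open>
  Since \<open>U t \<ge> b t\<close>, the doubling argument can start at any time \<open>t0\<close> with \<open>m = b t0\<close>. The choice of
  \<open>t0\<close> balances the two contributions to the bound: it solves \<open>(b t0) powr - ((p - 1) / 2) = t0\<close>.
\<close>
lemma life_time_le_velocity:
  assumes "0 < b"
  shows "T \<le> ereal ((1 + sqrt 2 / (1 - 2 powr - ((p - 1) / 2))) * b powr - ((p - 1) / (p + 1)))"
proof -
  define t0 where "t0 = b powr - ((p - 1) / (p + 1))"
  have "T \<le> ereal (t0 + sqrt 2 / (1 - 2 powr - ((p - 1) / 2)) * (b * t0) powr - ((p - 1) / 2))"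
    using U_ge_linear[of t0] a assms by (intro life_time_le) (auto simp: t0_def)
  also have "(b * t0) powr - ((p - 1) / 2) = t0"
  proof -
    have "b * t0 = b powr (1 - (p - 1) / (p + 1))"
      using assms powr_mult_base[of b "- ((p - 1) / (p + 1))"] by (simp add: t0_def)
    also have "1 - (p - 1) / (p + 1) = 2 / (p + 1)"
      using p by (simp add: field_simps)
    finally have "(b * t0) powr - ((p - 1) / 2) = b powr (2 / (p + 1) * - ((p - 1) / 2))"
      by (simp only: powr_powr)
    also have "2 / (p + 1) * - ((p - 1) / 2) = - ((p - 1) / (p + 1))"
      using p by (simp add: field_simps)
    finally show ?thesis
      by (simp only: t0_def)
  qed
  finally show ?thesis
    unfolding t0_def by (simp only: distrib_right mult_1)
qed

end

section \<open>The mean of an energy solution\<close>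

lemma deriv_eqI_open:
  assumes "open S" "s \<in> S" "\<And>r. r \<in> S \<Longrightarrow> h r = f r" "(f has_field_derivative D) (at s)"
  shows "deriv h s = D"
  using assms by (intro DERIV_imp_deriv has_field_derivative_transform_within_open[of f D s S h]) auto

text \<open>
  The function \<open>t - s\<close> of the time \<open>s\<close>, cut off after \<open>t\<close>, is an admissible test function that is
  constant on the group. Up to time \<open>t\<close> its second derivative and its Laplacian vanish, so the
  linear integral disappears; its value 0 and slope \<open>-1\<close> at time \<open>t\<close> remove \<open>\<partial>\<^sub>t u\<close> and leave the
  mean of \<open>u\<close>. Testing with \<open>t - s\<close> rather than 1 yields the twice integrated equation at once,
  with the initial data already built in.
\<close>
lemma energy_solution_mean:
  assumes man: "smooth_manifold E A" and met: "riemannian_metric A g"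
    and compact: "compact (UNIV :: 'g :: {t2_space, second_countable_topology} set)"
    and sol: "energy_solution M A (laplace_beltrami E A g) p u0 u1 \<epsilon> T (u :: real \<Rightarrow> 'g \<Rightarrow> real)"
    and t: "0 < t" "ereal t < T"
  shows "(\<integral>x. u t x \<partial>M) = \<epsilon> * (\<integral>x. u0 x \<partial>M) + \<epsilon> * (\<integral>x. u1 x \<partial>M) * t
    + (LINT s:{0..t}|lborel. (t - s) * (\<integral>x. \<bar>u s x\<bar> powr p \<partial>M))"
proof -
  obtain b where b: "t < b" "ereal b < T"
    using ereal_dense2[OF t(2)] by auto
  define a where "a = (t + b) / 2"
  have a: "t < a" "a < b" using b by (auto simp: a_def)
  obtain \<eta> where \<eta>: "\<And>k. k_diff k \<eta>" "\<And>t. t \<le> a \<Longrightarrow> \<eta> t = 1" "\<And>t. b \<le> t \<Longrightarrow> \<eta> t = 0"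
    using smooth_cutoff[OF a(2)] by blast
  define \<psi> :: "real \<Rightarrow> 'g \<Rightarrow> real" where "\<psi> = (\<lambda>s x. (t + (-1) * s) * \<eta> s)"
  define \<psi>s where "\<psi>s = (\<lambda>s x. deriv (\<lambda>r. \<psi> r x) s)"
  define \<psi>ss where "\<psi>ss = (\<lambda>s x. deriv (\<lambda>r. \<psi>s r x) s)"
  \<comment> \<open>The cutoff starts strictly after \<open>t\<close>, so the time derivatives at \<open>t\<close> itself are those of \<open>t - s\<close>.\<close>
  have \<psi>: "\<psi> s x = t - s" if "s < a" for s x
    using that by (simp add: \<psi>_def \<eta>(2))
  have \<psi>s: "\<psi>s s x = - 1" if "s < a" for s x
    unfolding \<psi>s_def using that
    by (intro deriv_eqI_open[of "{..<a}" _ _ "\<lambda>r. t - r"]) (auto simp: \<psi> intro!: derivative_eq_intros)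
  have \<psi>ss: "\<psi>ss s x = 0" if "s < a" for s x
    unfolding \<psi>ss_def using that
    by (intro deriv_eqI_open[of "{..<a}" _ _ "\<lambda>r. - 1"]) (auto simp: \<psi>s)
  have L: "laplace_beltrami E A g (\<psi> s) x = 0" for s x
    unfolding \<psi>_def by (rule laplace_beltrami_const[OF man met])
  have "k_diff k (\<lambda>s. (t + (-1) * s) * \<eta> s)" for k
    by (rule k_diff_mult[OF k_diff_add[OF k_diff_const k_diff_mult[OF k_diff_const
            k_diff_ident]] \<eta>(1)])
  then have "smooth_time_fun A \<psi>"
    unfolding \<psi>_def by (rule smooth_time_fun_time_only)
  moreover have "compact ({0..b} \<times> (UNIV :: 'g set))"
    by (intro compact_Times compact) simp
  moreover have "{0..b} \<times> (UNIV :: 'g set) \<subseteq> time_interval T \<times> UNIV"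
    using b by (auto simp: time_interval_def intro: le_less_trans[of _ "ereal b"])
  moreover have "\<psi> s x = 0" if "0 \<le> s \<and> (s, x) \<notin> {0..b} \<times> (UNIV :: 'g set)" for s x
    using that by (auto simp: \<psi>_def \<eta>(3))
  ultimately have test: "test_function A T \<psi>"
    unfolding test_function_def by blast
  obtain v where v: "(\<integral>x. v t x * \<psi> t x \<partial>M) - (\<integral>x. u t x * \<psi>s t x \<partial>M)
      - \<epsilon> * (\<integral>x. u1 x * \<psi> 0 x \<partial>M) + \<epsilon> * (\<integral>x. u0 x * \<psi>s 0 x \<partial>M)
      + (LINT s:{0..t}|lborel. (\<integral>x. u s x * (\<psi>ss s x - laplace_beltrami E A g (\<psi> s) x) \<partial>M))
      = (LINT s:{0..t}|lborel. (\<integral>x. \<bar>u s x\<bar> powr p * \<psi> s x \<partial>M))"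
    using sol test t unfolding energy_solution_def Let_def \<psi>ss_def \<psi>s_def by blast
  have 1: "(LINT s:{0..t}|lborel. (\<integral>x. u s x * (\<psi>ss s x - laplace_beltrami E A g (\<psi> s) x) \<partial>M))
      = (LINT s:{0..t}|lborel. 0)"
    using a by (intro set_lebesgue_integral_cong) (auto simp: L \<psi>ss)
  have 2: "(LINT s:{0..t}|lborel. (\<integral>x. \<bar>u s x\<bar> powr p * \<psi> s x \<partial>M))
      = (LINT s:{0..t}|lborel. (t - s) * (\<integral>x. \<bar>u s x\<bar> powr p \<partial>M))"
    using a by (intro set_lebesgue_integral_cong) (auto simp: \<psi>)
  have "0 < a" using t a by simp
  then show ?thesis
    using v[unfolded 1 2] a by (simp add: \<psi> \<psi>s set_lebesgue_integral_def algebra_simps)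
qed

text \<open>
  Compactness of the group makes \<open>{0..t} \<times> UNIV\<close> an admissible compact set in the local integrability
  condition; the claim is then Fubini's theorem.
\<close>
lemma Lp_loc_slices:
  assumes prob: "emeasure M (space M) = 1"
    and compact: "compact (UNIV :: 'g :: topological_space set)"
    and Lp: "Lp_loc M p T (u :: real \<Rightarrow> 'g \<Rightarrow> real)" and t: "0 \<le> t" "ereal t < T"
  shows "set_integrable lborel {0..t} (\<lambda>s. \<integral>x. \<bar>u s x\<bar> powr p \<partial>M)"
    and "AE s in lborel. s \<in> {0..t} \<longrightarrow> integrable M (\<lambda>x. \<bar>u s x\<bar> powr p)"
proof -
  interpret finite_measure M
    by standard (simp add: prob)
  interpret pair_sigma_finite lborel M ..
  have "compact ({0..t} \<times> (UNIV :: 'g set))"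
    by (intro compact_Times compact) simp
  moreover have "{0..t} \<times> (UNIV :: 'g set) \<subseteq> time_interval T \<times> UNIV"
    using t by (auto simp: time_interval_def intro: le_less_trans[of _ "ereal t"])
  ultimately have "set_integrable (lborel \<Otimes>\<^sub>M M) ({0..t} \<times> UNIV) (\<lambda>(s, x). \<bar>u s x\<bar> powr p)"
    using Lp unfolding Lp_loc_def by blast
  then have int: "integrable (lborel \<Otimes>\<^sub>M M) (\<lambda>z. indicator {0..t} (fst z) * \<bar>u (fst z) (snd z)\<bar> powr p)"
    unfolding set_integrable_def
    by (rule Bochner_Integration.integrable_cong[THEN iffD1, rotated -1])
       (auto simp: indicator_def)
  show "set_integrable lborel {0..t} (\<lambda>s. \<integral>x. \<bar>u s x\<bar> powr p \<partial>M)"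
    using integrable_fst'[OF int] by (simp add: set_integrable_def)
  show "AE s in lborel. s \<in> {0..t} \<longrightarrow> integrable M (\<lambda>x. \<bar>u s x\<bar> powr p)"
    using AE_integrable_fst'[OF int] by eventually_elim auto
qed

lemma L2_integrable:
  assumes "emeasure M (space M) = 1" "f \<in> L2 M"
  shows "integrable M f"
proof -
  interpret finite_measure M
    by standard (simp add: assms)
  have "integrable M (\<lambda>x. 1 + (f x)\<^sup>2)"
    using assms by (simp add: L2_def)
  then show ?thesis
  proof (rule Bochner_Integration.integrable_bound)
    show "f \<in> borel_measurable M" using assms by (simp add: L2_def)
    have "\<bar>y\<bar> \<le> 1 + y\<^sup>2" for y :: real
      using zero_le_power2[of "\<bar>y\<bar> - 1"] by (simp add: power2_eq_square algebra_simps)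
    then show "AE x in M. norm (f x) \<le> norm (1 + (f x)\<^sup>2)" by simp
  qed
qed

text \<open>
  The identity for the mean is available for \<open>t > 0\<close> only. Its right-hand side, which has the value
  \<open>\<epsilon> I0\<close> at time 0, is therefore taken as \<open>U\<close>, and this agrees with the mean at all positive times.
\<close>
lemma energy_solution_iteration_frame:
  assumes man: "smooth_manifold E A" and met: "riemannian_metric A g"
    and compact: "compact (UNIV :: 'g :: {t2_space, second_countable_topology} set)"
    and prob: "emeasure M (space M) = 1" and p: "1 < p" and \<epsilon>: "0 < \<epsilon>"
    and data: "0 \<le> (\<integral>x. u0 x \<partial>M)" "0 \<le> (\<integral>x. u1 x \<partial>M)"
    and sol: "energy_solution M A (laplace_beltrami E A g) p u0 u1 \<epsilon> T (u :: real \<Rightarrow> 'g \<Rightarrow> real)"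
  defines "N \<equiv> \<lambda>s. \<integral>x. \<bar>u s x\<bar> powr p \<partial>M"
  shows "iteration_frame p (\<epsilon> * (\<integral>x. u0 x \<partial>M)) (\<epsilon> * (\<integral>x. u1 x \<partial>M)) T N
    (\<lambda>t. \<epsilon> * (\<integral>x. u0 x \<partial>M) + \<epsilon> * (\<integral>x. u1 x \<partial>M) * t + (LINT s:{0..t}|lborel. (t - s) * N s))"
proof
  have Lp: "Lp_loc M p T u" and cont: "continuous_in (H1 M A (laplace_beltrami E A g))
      (H1_norm M A (laplace_beltrami E A g)) T u"
    using sol by (auto simp: energy_solution_def)
  note slices = Lp_loc_slices[OF prob compact Lp]
  show "set_integrable lborel {0..t} N" if "0 \<le> t" "ereal t < T" for t
    using slices(1)[OF that] by (simp add: N_def)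
  show "0 \<le> N s" for s
    by (simp add: N_def)
  show "AE s in lborel. 0 < s \<and> s \<le> t \<longrightarrow> (\<forall>m. 0 < m \<and>
      m \<le> \<epsilon> * (\<integral>x. u0 x \<partial>M) + \<epsilon> * (\<integral>x. u1 x \<partial>M) * s + (LINT r:{0..s}|lborel. (s - r) * N r)
      \<longrightarrow> m powr p \<le> N s)"
    if "0 \<le> t" "ereal t < T" for t
    using slices(2)[OF that]
  proof eventually_elim
    case (elim s)
    show ?case
    proof safe
      fix m
      assume s: "0 < s" "s \<le> t" and m: "0 < m"
        "m \<le> \<epsilon> * (\<integral>x. u0 x \<partial>M) + \<epsilon> * (\<integral>x. u1 x \<partial>M) * s + (LINT r:{0..s}|lborel. (s - r) * N r)"
      have "ereal s < T" using s that by (meson ereal_less_eq(3) le_less_trans)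
      then have "m \<le> (\<integral>x. u s x \<partial>M)"
        using energy_solution_mean[OF man met compact sol s(1)] m(2) by (simp add: N_def)
      moreover have "u s \<in> L2 M"
        using cont s \<open>ereal s < T\<close> by (auto simp: continuous_in_def time_interval_def H1_def)
      ultimately show "m powr p \<le> N s"
        unfolding N_def using prob p m(1) elim s
        by (intro powr_le_integral_powr) (auto intro: L2_integrable)
    qed
  qed
qed (use p \<epsilon> data in auto)

section \<open>The lifespan estimate\<close>

theorem theorem1p3:
  fixes E :: "'e::real_normed_vector set"
    and A :: "('g::{t2_space, second_countable_topology}, 'e) chart set"
    and gmult :: "'g \<Rightarrow> 'g \<Rightarrow> 'g" and gunit :: 'g and ginv :: "'g \<Rightarrow> 'g"
    and g :: "('g, 'e) metric"
    and M :: "'g measure"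
    and L :: "('g \<Rightarrow> real) \<Rightarrow> 'g \<Rightarrow> real"
    and u0 u1 :: "'g \<Rightarrow> real"
    and p :: real
  assumes "compact_lie_group E A gmult gunit ginv"
    and "bi_invariant_metric A gmult g"
    and "L = laplace_beltrami E A g"
    and "normalized_haar_measure gmult M"
    and "u0 \<in> H1 M A L" and "u1 \<in> L2 M"
    and "AE x in M. 0 \<le> u0 x" and "AE x in M. 0 \<le> u1 x"
    and "\<not> ((AE x in M. u0 x = 0) \<and> (AE x in M. u1 x = 0))"
    and "1 < p"
  shows "\<exists>\<epsilon>0::real. 0 < \<epsilon>0 \<and>
    (\<forall>\<epsilon>\<in>{0<..\<epsilon>0}. \<forall>T u. energy_solution M A L p u0 u1 \<epsilon> T u \<longrightarrow>
        lifespan M A L p u0 u1 \<epsilon> T u < \<infinity>) \<and>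
    (\<exists>C::real. 0 < C \<and>
      (\<forall>\<epsilon>\<in>{0<..\<epsilon>0}. \<forall>T u. energy_solution M A L p u0 u1 \<epsilon> T u \<longrightarrow>
        lifespan M A L p u0 u1 \<epsilon> T u \<le>
          ereal (if \<not> (AE x in M. u1 x = 0)
                 then C * \<epsilon> powr (- ((p - 1) / (p + 1)))
                 else C * \<epsilon> powr (- ((p - 1) / 2)))))"
proof -
  interpret compact_lie_group E A gmult gunit ginv by fact
  have man: "smooth_manifold E A" ..
  have met: "riemannian_metric A g"
    using assms(2) by (simp add: bi_invariant_metric_def)
  have prob: "emeasure M (space M) = 1"
    using assms(4) by (simp add: normalized_haar_measure_def)
  have int: "integrable M u0" "integrable M u1"
    using assms(5,6) by (auto intro!: L2_integrable[OF prob] simp: H1_def)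
  define I0 I1 where "I0 = (\<integral>x. u0 x \<partial>M)" and "I1 = (\<integral>x. u1 x \<partial>M)"
  have I: "0 \<le> I0" "0 \<le> I1"
    unfolding I0_def I1_def using assms(7,8) by (auto intro: integral_nonneg_AE)
  have I0_iff: "I0 = 0 \<longleftrightarrow> (AE x in M. u0 x = 0)" and I1_iff: "I1 = 0 \<longleftrightarrow> (AE x in M. u1 x = 0)"
    unfolding I0_def I1_def
    using int assms(7,8) by (auto intro!: integral_nonneg_eq_0_iff_AE)
  define D where "D = 1 + sqrt 2 / (1 - 2 powr - ((p - 1) / 2))"
  have D: "1 < D"
    using assms(10) powr_less_mono[of "- ((p - 1) / 2)" 0 "2::real"] by (simp add: D_def)
  define bound where "bound = (\<lambda>C \<epsilon>. if \<not> (AE x in M. u1 x = 0)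
      then C * \<epsilon> powr (- ((p - 1) / (p + 1))) else C * \<epsilon> powr (- ((p - 1) / 2)))"
  define C where "C = (if \<not> (AE x in M. u1 x = 0)
      then D * I1 powr - ((p - 1) / (p + 1)) else (D - 1) * I0 powr - ((p - 1) / 2))"
  have "0 < C"
    using D I I0_iff I1_iff assms(9) by (auto simp: C_def)
  \<comment> \<open>The bound applies to every interval of existence of every solution, hence also to all
    continuations that enter the lifespan.\<close>
  have existence: "T \<le> ereal (bound C \<epsilon>)"
    if "0 < \<epsilon>" "energy_solution M A L p u0 u1 \<epsilon> T u" for \<epsilon> T u
  proof -
    interpret iteration_frame p "\<epsilon> * I0" "\<epsilon> * I1" T "\<lambda>s. \<integral>x. \<bar>u s x\<bar> powr p \<partial>M"
      "\<lambda>t. \<epsilon> * I0 + \<epsilon> * I1 * t + (LINT s:{0..t}|lborel. (t - s) * (\<integral>x. \<bar>u s x\<bar> powr p \<partial>M))"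
      using energy_solution_iteration_frame[OF man met compact_group prob assms(10) that(1)] I that(2)
      by (simp add: I0_def I1_def assms(3))
    show ?thesis
    proof (cases "AE x in M. u1 x = 0")
      case True
      then have "0 < I0" using I0_iff assms(9) I by auto
      then show ?thesis
        using life_time_le_position that(1) True
        by (simp add: bound_def C_def D_def powr_mult mult_ac)
    next
      case False
      then have "0 < I1" using I1_iff I by auto
      then show ?thesis
        using life_time_le_velocity that(1) False
        by (simp add: bound_def C_def D_def powr_mult mult_ac)
    qed
  qed
  have life: "lifespan M A L p u0 u1 \<epsilon> T u \<le> ereal (bound C \<epsilon>)" if "0 < \<epsilon>" for \<epsilon> T u
    unfolding lifespan_def using existence[OF that] by (auto intro!: Sup_least)
  then have "lifespan M A L p u0 u1 \<epsilon> T u < \<infinity>" if "0 < \<epsilon>" for \<epsilon> T u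
    using that by (meson ereal_less_PInfty le_less_trans less_ereal.simps(4))
  then show ?thesis
    using life \<open>0 < C\<close> unfolding bound_def
    by (intro exI[of _ 1] conjI exI[of _ C]) auto
qed

end
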